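(* Let $J$ be an ideal on $\omega$. The following are equivalent: (i) $\mathcal{N}^*_J\not\subseteq\mathcal{M}$; (ii) $\mathcal{N}^*_J\not\subseteq\mathcal{M}\cap\mathcal{N}$; (iii) $\mathcal{E}\subsetneq\mathcal{N}^*_J$; (iv) $J$ is not meager.
   Context: An ideal on $\omega$ is a family $J\subseteq\mathcal{P}(\omega)$ closed under subsets and finite unions, containing all finite sets, with $\omega\notin J$; it is viewed as a subset of $\mathcal{P}(\omega)\cong{}^\omega2$ for "meager". $J^d=\{\omega\setminus a:a\in J\}$. ${}^\omega2$ has Lebesgue measure $\mu$; $\Omega$ is the set of clopen subsets. For $\bar c\in{}^\omega\Omega$, $N(\bar c)=\{x:x\in c_n\text{ for infinitely many }n\}$, $\overline{\Omega}=\{\bar c\in{}^\omega\Omega:\mu(N(\bar c))=0\}$, $N^*_J(\bar c)=\{x:\{n:x\in c_n\}\in J^d\}$, $\mathcal{N}^*_J=\{X\subseteq{}^\omega2:\exists\bar c\in\overline{\Omega}\ X\subseteq N^*_J(\bar c)\}$. $\mathcal{N}$, $\mathcal{M}$ are the ideals of null and meager subsets of ${}^\omega2$, and $\mathcal{E}$ is the $\sigma$-ideal generated by closed null subsets of ${}^\omega2$. *)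

theory Defs
  imports "HOL-Probability.Probability"
begin

text \<open>The Cantor space is the type \<^typ>\<open>nat \<Rightarrow> bool\<close>; \<^const>\<open>open\<close> and \<^const>\<open>closed\<close> on it
  refer to the product of the discrete topologies on \<^typ>\<open>bool\<close>.\<close>

type_synonym cantor = "nat \<Rightarrow> bool"

definition nowhere_dense :: "'a::topological_space set \<Rightarrow> bool" where
  "nowhere_dense A \<longleftrightarrow> interior (closure A) = {}"

definition meager :: "'a::topological_space set \<Rightarrow> bool" where
  "meager X \<longleftrightarrow> (\<exists>A :: nat \<Rightarrow> 'a set. (\<forall>n. nowhere_dense (A n)) \<and> X = (\<Union>n. A n))"

text \<open>The product measure is completed so that \<^const>\<open>null_sets\<close> yields all null subsets, not
  only the Borel ones.\<close>

definition cantor_measure :: "cantor measure" where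
  "cantor_measure = completion (PiM UNIV (\<lambda>_. uniform_count_measure (UNIV :: bool set)))"

definition null_ideal :: "cantor set set" where
  "null_ideal = null_sets cantor_measure"

definition meager_ideal :: "cantor set set" where
  "meager_ideal = {X. meager X}"

definition sigma_ideal :: "'a set set \<Rightarrow> bool" where
  "sigma_ideal I \<longleftrightarrow> {} \<in> I \<and> (\<forall>A\<in>I. \<forall>B. B \<subseteq> A \<longrightarrow> B \<in> I)
     \<and> (\<forall>A :: nat \<Rightarrow> 'a set. range A \<subseteq> I \<longrightarrow> (\<Union>n. A n) \<in> I)"

definition sigma_ideal_generated :: "'a set set \<Rightarrow> 'a set set" where
  "sigma_ideal_generated G = \<Inter>{I. sigma_ideal I \<and> G \<subseteq> I}"

definition closed_null_ideal :: "cantor set set" where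
  "closed_null_ideal = sigma_ideal_generated {C. closed C \<and> C \<in> null_sets cantor_measure}"

definition ideal_on_omega :: "nat set set \<Rightarrow> bool" where
  "ideal_on_omega J \<longleftrightarrow> (\<forall>a\<in>J. \<forall>b. b \<subseteq> a \<longrightarrow> b \<in> J) \<and> (\<forall>a\<in>J. \<forall>b\<in>J. a \<union> b \<in> J)
     \<and> (\<forall>a. finite a \<longrightarrow> a \<in> J) \<and> UNIV \<notin> J"

definition dual_filter :: "nat set set \<Rightarrow> nat set set" where
  "dual_filter J = {UNIV - a | a. a \<in> J}"

text \<open>Subsets of \<open>\<P>(\<omega>)\<close> are transported to the Cantor space along characteristic functions.\<close>

definition meager_family :: "nat set set \<Rightarrow> bool" where
  "meager_family J \<longleftrightarrow> meager ((\<lambda>a n. n \<in> a) ` J :: cantor set)"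

definition clopen_sets :: "cantor set set" where
  "clopen_sets = {c. open c \<and> closed c}"

definition N_limsup :: "(nat \<Rightarrow> cantor set) \<Rightarrow> cantor set" where
  "N_limsup c = {x. infinite {n. x \<in> c n}}"

definition Omega_bar :: "(nat \<Rightarrow> cantor set) set" where
  "Omega_bar = {c. (\<forall>n. c n \<in> clopen_sets) \<and> N_limsup c \<in> null_sets cantor_measure}"

definition N_star :: "nat set set \<Rightarrow> (nat \<Rightarrow> cantor set) \<Rightarrow> cantor set" where
  "N_star J c = {x. {n. x \<in> c n} \<in> dual_filter J}"

definition N_star_family :: "nat set set \<Rightarrow> cantor set set" where
  "N_star_family J = {X. \<exists>c\<in>Omega_bar. X \<subseteq> N_star J c}"

end

theory Submission
  imports Defs
begin

text \<open>
  A meager subset of the Cantor space is covered by a set of the form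
  \<open>{x. for almost all n, x differs from z somewhere on [k n, k (n+1))}\<close>, where the block
  boundaries can be chosen inside any prescribed infinite set.

  If the ideal \<open>J\<close> is meager, this yields blocks that almost all meet each given set of the dual
  filter. Replacing the clopen sets \<open>c i\<close> by their unions over the blocks does not change the limsup,
  but it turns membership modulo \<open>J\<close> into membership for almost all indices, so every member of
  \<open>N_star_family J\<close> is covered by countably many closed null sets.

  If \<open>J\<close> is not meager, let \<open>c j\<close> be the set of points vanishing on the interval
  \<open>[j^2, (j+1)^2)\<close>. By Borel--Cantelli \<open>c\<close> lies in \<open>Omega_bar\<close>, and \<open>N_star J c\<close> is the preimage of
  \<open>J\<close> under the map sending \<open>x\<close> to the set of \<open>j\<close> such that \<open>x\<close> does not vanish on the \<open>j\<close>-th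
  interval. A covering of this preimage as above, with boundaries at squares, is pushed forward
  to a covering of \<open>J\<close> of the same kind, so the preimage cannot be meager.
\<close>

section \<open>Topology of the Cantor space\<close>

definition cylinder :: "nat \<Rightarrow> cantor \<Rightarrow> cantor set" where
  "cylinder n x = {y. \<forall>i<n. y i = x i}"

lemma cylinder_self: "x \<in> cylinder n x"
  by (simp add: cylinder_def)

lemma cylinder_antimono: "m \<le> n \<Longrightarrow> cylinder n x \<subseteq> cylinder m x"
  by (auto simp: cylinder_def)

lemma open_coordinates_eq:
  fixes s :: cantor
  assumes "finite A"
  shows "open {x. \<forall>i\<in>A. x i = s i}"
proof -
  have "open (Pi\<^sub>E UNIV (\<lambda>i. if i \<in> A then {s i} else UNIV))"
    by (rule open_PiE) (use assms in \<open>auto intro: Topological_Spaces.open_discrete finite_subset[of _ A]\<close>)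
  moreover have "Pi\<^sub>E UNIV (\<lambda>i. if i \<in> A then {s i} else UNIV) = {x. \<forall>i\<in>A. x i = s i}"
    by (auto simp: PiE_def Pi_def split: if_splits)
  ultimately show ?thesis by simp
qed

lemma open_cylinder: "open (cylinder n x)"
  using open_coordinates_eq[of "{..<n}" x] by (simp add: cylinder_def Ball_def)

text \<open>A basic open box of the product restricts only finitely many coordinates, so around each
  of its points it contains a cylinder reaching beyond all of them.\<close>

lemma open_cantor_iff: "open U \<longleftrightarrow> (\<forall>x\<in>U. \<exists>n. cylinder n x \<subseteq> U)"
proof (intro iffI ballI)
  fix x :: cantor
  assume U: "open U" and x: "x \<in> U"
  have "\<exists>X. x \<in> Pi\<^sub>E UNIV X \<and> (\<forall>i. openin (euclidean::bool topology) (X i))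
      \<and> finite {i. X i \<noteq> topspace (euclidean::bool topology)} \<and> Pi\<^sub>E UNIV X \<subseteq> U"
    by (rule product_topology_open_contains_basis) (use U x in \<open>simp_all add: open_fun_def\<close>)
  then obtain X where X: "x \<in> Pi\<^sub>E UNIV X" "finite {i. X i \<noteq> (UNIV :: bool set)}" "Pi\<^sub>E UNIV X \<subseteq> U"
    by auto
  obtain n where n: "{i. X i \<noteq> UNIV} \<subseteq> {..<n}"
    using X(2) finite_nat_iff_bounded by blast
  have "cylinder n x \<subseteq> Pi\<^sub>E UNIV X"
  proof
    fix y assume y: "y \<in> cylinder n x"
    have "y i \<in> X i" for i
    proof (cases "X i = UNIV")
      case False
      then have "i < n" using n by auto
      then show ?thesis using y X(1) by (auto simp: cylinder_def PiE_def)
    qed simp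
    then show "y \<in> Pi\<^sub>E UNIV X" by auto
  qed
  then show "\<exists>n. cylinder n x \<subseteq> U" using X(3) by blast
next
  assume "\<forall>x\<in>U. \<exists>n. cylinder n x \<subseteq> U"
  then show "open U"
    by (subst open_subopen) (meson cylinder_self open_cylinder)
qed

text \<open>The hypothesis is symmetric in \<open>A\<close> and its complement, so one openness
  argument yields both claims.\<close>

lemma clopen_if_finite_support:
  assumes "\<And>x y. y \<in> cylinder n x \<Longrightarrow> x \<in> A \<longleftrightarrow> y \<in> A"
  shows "open A" and "closed A"
proof -
  have "open B" if "\<And>x y. y \<in> cylinder n x \<Longrightarrow> x \<in> B \<Longrightarrow> y \<in> B" for B
    using that by (subst open_cantor_iff) blast
  from this[of A] this[of "- A"] show "open A" "closed A"
    using assms by (simp_all add: closed_def)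
qed

text \<open>Cutting a cover down to \<open>X \<inter> F n\<close> keeps the closures inside
  \<open>F n\<close>. The cover form replaces the equality in \<open>meager\<close> by an inclusion
  and so passes to subsets.\<close>

lemma meager_iff_closed_cover:
  "meager X \<longleftrightarrow> (\<exists>F :: nat \<Rightarrow> 'a::topological_space set.
     (\<forall>n. closed (F n) \<and> interior (F n) = {}) \<and> X \<subseteq> (\<Union>n. F n))"
  (is "_ \<longleftrightarrow> ?cover")
proof
  assume "meager X"
  then obtain A :: "nat \<Rightarrow> 'a set" where "\<forall>n. nowhere_dense (A n)" "X = (\<Union>n. A n)"
    unfolding meager_def by blast
  then show ?cover
    by (intro exI[of _ "\<lambda>n. closure (A n)"])
      (auto simp: nowhere_dense_def intro: closure_subset[THEN subsetD])
next
  assume ?cover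
  then obtain F :: "nat \<Rightarrow> 'a set" where
    F: "\<And>n. closed (F n)" "\<And>n. interior (F n) = {}" "X \<subseteq> (\<Union>n. F n)"
    by blast
  have "interior (closure (X \<inter> F n)) \<subseteq> interior (F n)" for n
    by (intro interior_mono closure_minimal F) auto
  then have "nowhere_dense (X \<inter> F n)" for n
    using F(2) by (auto simp: nowhere_dense_def)
  then show "meager X"
    unfolding meager_def using F(3) by (intro exI[of _ "\<lambda>n. X \<inter> F n"]) auto
qed

lemma meager_subset: "meager Y \<Longrightarrow> X \<subseteq> Y \<Longrightarrow> meager X"
  unfolding meager_iff_closed_cover by (elim exE conjE, intro exI conjI, assumption, rule subset_trans)

lemma closed_empty_interior_UN_atMost:
  fixes F :: "nat \<Rightarrow> 'a::topological_space set"
  assumes "\<And>n. closed (F n)" "\<And>n. interior (F n) = {}"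
  shows "closed (\<Union>i\<le>n. F i) \<and> interior (\<Union>i\<le>n. F i) = {}"
proof (induction n)
  case (Suc n)
  then show ?case
    using assms interior_closed_Un_empty_interior[OF assms(1), of "\<Union>i\<le>n. F i" "Suc n"]
    by (simp add: atMost_Suc closed_Un)
qed (use assms in auto)

section \<open>Meager sets and block partitions\<close>

text \<open>Closing a nowhere dense set under flips of the first \<open>k\<close> coordinates makes avoiding it a
  matter of the remaining coordinates only.\<close>

lemma closed_nowhere_dense_tail_hull:
  fixes F :: "cantor set"
  assumes "closed F" "interior F = {}"
  shows "\<exists>F'. F \<subseteq> F' \<and> closed F' \<and> interior F' = {}
    \<and> (\<forall>x y. (\<forall>i\<ge>k. x i = y i) \<longrightarrow> x \<in> F' \<longrightarrow> y \<in> F')"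
proof (induction k)
  case 0
  have "x = y" if "\<forall>i\<ge>(0::nat). x i = y i" for x y :: cantor
    using that by auto
  then show ?case using assms by (intro exI[of _ F]) blast
next
  case (Suc k)
  then obtain F' where F': "F \<subseteq> F'" "closed F'" "interior F' = {}"
    and inv: "\<And>x y. (\<forall>i\<ge>k. x i = y i) \<Longrightarrow> x \<in> F' \<Longrightarrow> y \<in> F'"
    by blast
  \<comment> \<open>Toggling coordinate \<open>k\<close> is an involutive homeomorphism, so the
    preimage of \<open>F'\<close> under it is again closed with empty interior. Points agreeing from
    \<open>Suc k\<close> on agree from \<open>k\<close> on after at most one flip.\<close>
  define flip :: "cantor \<Rightarrow> cantor" where "flip x = x(k := \<not> x k)" for x
  have flip_flip: "flip (flip x) = x" for x
    by (simp add: flip_def)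
  have flip_cylinder: "flip y \<in> cylinder n (flip x)" if "y \<in> cylinder n x" for n x y
    using that by (auto simp: cylinder_def flip_def)
  have open_flip: "open (flip -` U)" if "open U" for U
  proof (subst open_cantor_iff, rule ballI)
    fix x assume "x \<in> flip -` U"
    then obtain n where "cylinder n (flip x) \<subseteq> U"
      using \<open>open U\<close> open_cantor_iff by blast
    then have "cylinder n x \<subseteq> flip -` U" using flip_cylinder by blast
    then show "\<exists>n. cylinder n x \<subseteq> flip -` U" by blast
  qed
  have closed_flip: "closed (flip -` F')"
    using open_flip[of "- F'"] F'(2) by (simp add: closed_def vimage_Compl)
  have interior_flip: "interior (flip -` F') = {}"
  proof -
    have "flip -` interior (flip -` F') \<subseteq> flip -` (flip -` F')"
      by (intro vimage_mono interior_subset)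
    also have "\<dots> = F'" by (simp add: vimage_def flip_flip)
    finally have "flip -` interior (flip -` F') \<subseteq> interior F'"
      by (intro interior_maximal open_flip open_interior)
    then have "flip -` (flip -` interior (flip -` F')) = {}" using F'(3) by auto
    then show ?thesis by (simp add: vimage_def flip_flip)
  qed
  have "y \<in> F' \<union> flip -` F'" if "\<forall>i\<ge>Suc k. x i = y i" "x \<in> F' \<union> flip -` F'" for x y
  proof (cases "x k = y k")
    case True
    then have "\<forall>i\<ge>k. x i = y i" "\<forall>i\<ge>k. flip x i = flip y i"
      using that(1) by (auto simp: flip_def not_less_eq_eq[symmetric] dest: le_antisym)
    then show ?thesis using that(2) inv by blast
  next
    case False
    then have "\<forall>i\<ge>k. x i = flip y i" "\<forall>i\<ge>k. flip x i = y i"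
      using that(1) by (auto simp: flip_def not_less_eq_eq[symmetric] dest: le_antisym)
    then show ?thesis using that(2) inv by blast
  qed
  moreover have "interior (F' \<union> flip -` F') = {}"
    using interior_closed_Un_empty_interior[OF F'(2) interior_flip] F'(3) by simp
  moreover have "closed (F' \<union> flip -` F')" using F'(2) closed_flip by (rule closed_Un)
  moreover have "F \<subseteq> F' \<union> flip -` F'" using F'(1) by blast
  ultimately show ?case by (intro exI[of _ "F' \<union> flip -` F'"] conjI allI impI)
qed

text \<open>The hull of \<open>F\<close> under changes below \<open>k\<close> is not the whole
  space, so some cylinder of length \<open>m\<close> around a point \<open>s\<close> misses it.
  Overwriting a point below \<open>k\<close> by \<open>s\<close> preserves membership in the hull,
  so only the values on \<open>[k, m)\<close> matter.\<close>

lemma closed_nowhere_dense_avoid_block: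
  fixes F :: "cantor set"
  assumes "closed F" "interior F = {}"
  shows "\<exists>m s. \<forall>y. (\<forall>i\<in>{k..<m}. y i = s i) \<longrightarrow> y \<notin> F"
proof -
  obtain F' where F': "F \<subseteq> F'" "closed F'" "interior F' = {}"
    and inv: "\<And>x y. (\<forall>i\<ge>k. x i = y i) \<Longrightarrow> x \<in> F' \<Longrightarrow> y \<in> F'"
    using closed_nowhere_dense_tail_hull[OF assms, of k] by blast
  have "F' \<noteq> UNIV" using F'(3) by auto
  then obtain s where "s \<in> - F'" by auto
  then obtain m where m: "cylinder m s \<subseteq> - F'"
    using F'(2) by (metis closed_def open_cantor_iff)
  have "y \<notin> F" if y: "\<forall>i\<in>{k..<m}. y i = s i" for y
  proof
    assume "y \<in> F"
    then have "y \<in> F'" using F'(1) by blast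
    then have "(\<lambda>i. if i < k then s i else y i) \<in> F'"
      by (rule inv[rotated]) simp
    moreover have "(\<lambda>i. if i < k then s i else y i) \<in> cylinder m s"
      using y by (auto simp: cylinder_def)
    ultimately show False using m by blast
  qed
  then show ?thesis by blast
qed

text \<open>The complement of the set of points matching \<open>z\<close> on infinitely many blocks.
  For strictly increasing \<open>k\<close> these sets form a cofinal family of meager sets.\<close>

definition eventually_differs :: "(nat \<Rightarrow> nat) \<Rightarrow> cantor \<Rightarrow> cantor set" where
  "eventually_differs k z =
     {x. \<forall>\<^sub>F n in sequentially. \<exists>i\<in>{k n..<k (Suc n)}. x i \<noteq> z i}"

text \<open>Block \<open>n\<close> is chosen so long that copying a suitable pattern on it forces a
  point out of \<open>F 0\<close>, ..., \<open>F n\<close>, and \<open>z\<close> concatenates these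
  patterns. A point of \<open>F j\<close> therefore differs from \<open>z\<close> on every block
  from \<open>j\<close> on. The map \<open>g\<close> prescribes where boundaries may lie.\<close>

lemma meager_subset_eventually_differs:
  fixes g :: "nat \<Rightarrow> nat"
  assumes "meager X" and g: "strict_mono g"
  shows "\<exists>(k :: nat \<Rightarrow> nat) z. strict_mono k \<and> X \<subseteq> eventually_differs (g \<circ> k) z"
proof -
  obtain F :: "nat \<Rightarrow> cantor set" where
    F: "\<And>n. closed (F n)" "\<And>n. interior (F n) = {}" "X \<subseteq> (\<Union>n. F n)"
    using assms(1) unfolding meager_iff_closed_cover by blast
  define avoids where
    "avoids n j j' s \<longleftrightarrow> (\<forall>y. (\<forall>i\<in>{g j..<g j'}. y i = s i) \<longrightarrow> y \<notin> (\<Union>i\<le>n. F i))" for n j j' s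
  have "\<exists>j' s. j < j' \<and> avoids n j j' s" for n j
  proof -
    obtain m s where ms: "\<forall>y. (\<forall>i\<in>{g j..<m}. y i = s i) \<longrightarrow> y \<notin> (\<Union>i\<le>n. F i)"
      using closed_nowhere_dense_avoid_block[of "\<Union>i\<le>n. F i" "g j"]
        closed_empty_interior_UN_atMost[of F n, OF F(1,2)] by blast
    \<comment> \<open>Lengthening the block up to a value of \<open>g\<close> only strengthens the
      agreement demanded of \<open>y\<close>; \<open>Suc j\<close> keeps the new index above
      \<open>j\<close>.\<close>
    have "m \<le> g (max m (Suc j))"
      using strict_mono_imp_increasing[OF g, of "max m (Suc j)"] by linarith
    then show ?thesis
      using ms by (intro exI[of _ "max m (Suc j)"] exI[of _ s]) (auto simp: avoids_def)
  qed
  then have "\<forall>n. \<forall>j. \<exists>j'. j < j' \<and> (\<exists>s. avoids n j j' s)" by blast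
  then obtain next_index where next_index:
    "\<forall>n. \<forall>j. j < next_index n j \<and> (\<exists>s. avoids n j (next_index n j) s)"
    unfolding choice_iff by blast
  then have "\<forall>n. \<forall>j. \<exists>s. avoids n j (next_index n j) s" by blast
  then obtain S where "\<forall>n. \<forall>j. avoids n j (next_index n j) (S n j)"
    unfolding choice_iff by blast
  with next_index have step: "\<And>n j. j < next_index n j"
    "\<And>n j. avoids n j (next_index n j) (S n j)"
    by auto
  define k where "k = rec_nat 0 (\<lambda>n j. next_index n j)"
  have k_Suc: "k (Suc n) = next_index n (k n)" for n
    by (simp add: k_def)
  have mono_k: "strict_mono k"
    by (simp add: strict_mono_Suc_iff k_Suc step(1))
  have mono_gk: "strict_mono (g \<circ> k)"
    using g mono_k by (rule strict_mono_o)
  \<comment> \<open>The least such \<open>n\<close> is the number of the block containing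
    \<open>i\<close>; positions before the first block fall to \<open>n = 0\<close>.\<close>
  define z where "z i = (let n = LEAST n. i < g (k (Suc n)) in S n (k n) i)" for i
  have z_block: "z i = S n (k n) i" if i: "i \<in> {g (k n)..<g (k (Suc n))}" for n i
  proof -
    have "(LEAST m. i < g (k (Suc m))) = n"
    proof (rule Least_equality)
      fix m assume "i < g (k (Suc m))"
      then have "(g \<circ> k) n < (g \<circ> k) (Suc m)" using i by simp
      then show "n \<le> m" using strict_mono_less[OF mono_gk] by simp
    qed (use i in auto)
    then show ?thesis by (simp add: z_def)
  qed
  have "x \<in> eventually_differs (g \<circ> k) z" if "x \<in> X" for x
  proof -
    obtain j where j: "x \<in> F j" using F(3) \<open>x \<in> X\<close> by blast
    have "\<exists>i\<in>{(g \<circ> k) n..<(g \<circ> k) (Suc n)}. x i \<noteq> z i" if "n \<ge> j" for n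
    proof (rule ccontr)
      assume "\<not> ?thesis"
      then have "\<forall>i\<in>{g (k n)..<g (next_index n (k n))}. x i = S n (k n) i"
        using z_block by (simp add: k_Suc)
      with step(2)[of n "k n"] have "x \<notin> (\<Union>i\<le>n. F i)" by (simp add: avoids_def)
      then show False using j that by blast
    qed
    then show ?thesis
      unfolding eventually_differs_def eventually_sequentially by blast
  qed
  then show ?thesis using mono_k by blast
qed

text \<open>The points differing from \<open>z\<close> on all blocks from \<open>m\<close> on form a
  closed set. It contains no cylinder, because some point of the cylinder copies \<open>z\<close>
  beyond the cylinder's length.\<close>

lemma meager_eventually_differs:
  assumes "strict_mono k"
  shows "meager (eventually_differs k z)"
proof -
  define D where "D n = {x. \<exists>i\<in>{k n..<k (Suc n)}. x i \<noteq> z i}" for n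
  define F where "F m = (\<Inter>n\<in>{m..}. D n)" for m
  have "closed (D n)" for n
    by (rule clopen_if_finite_support(2)[of "k (Suc n)"]) (auto simp: D_def cylinder_def)
  then have "closed (F m)" for m
    by (auto simp: F_def)
  moreover have "interior (F m) = {}" for m
  proof (rule ccontr)
    assume "interior (F m) \<noteq> {}"
    then obtain x n where n: "cylinder n x \<subseteq> interior (F m)"
      using open_interior[of "F m"] unfolding open_cantor_iff by blast
    define y where "y i = (if i < n then x i else z i)" for i
    have "y \<in> cylinder n x" by (simp add: cylinder_def y_def)
    then have "y \<in> D (max m n)"
      using n interior_subset by (force simp: F_def)
    moreover have "n \<le> k (max m n)"
      using strict_mono_imp_increasing[OF assms, of "max m n"] by linarith
    ultimately show False by (auto simp: D_def y_def)
  qed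
  moreover have "eventually_differs k z \<subseteq> (\<Union>m. F m)"
    by (auto simp: eventually_differs_def eventually_sequentially F_def D_def)
  ultimately show ?thesis unfolding meager_iff_closed_cover by blast
qed

section \<open>Measure on the Cantor space\<close>

lemma prob_space_cantor_measure: "prob_space cantor_measure"
  unfolding cantor_measure_def
  by (intro prob_space.prob_space_completion prob_space_PiM prob_space_uniform_count_measure) auto

interpretation cantor: prob_space cantor_measure
  by (rule prob_space_cantor_measure)

lemma null_cantor_subset:
  "A \<in> null_sets cantor_measure \<Longrightarrow> B \<subseteq> A \<Longrightarrow> B \<in> null_sets cantor_measure"
  unfolding cantor_measure_def by (rule null_sets_completion_subset)

text \<open>Second countability makes \<open>sets_PiM_equal_borel\<close> applicable; all subsets of
  a finite discrete space form a countable subbase.\<close>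

instance bool :: second_countable_topology
proof
  have "open = generate_topology (UNIV :: bool set set)"
    by (auto simp: fun_eq_iff intro: Topological_Spaces.open_discrete generate_topology.Basis)
  then show "\<exists>B :: bool set set. countable B \<and> open = generate_topology B"
    by (intro exI[of _ UNIV]) simp
qed

lemma sets_PiM_bool_eq_borel:
  "sets (PiM UNIV (\<lambda>_::nat. uniform_count_measure (UNIV :: bool set))) = sets borel"
proof -
  have borel_bool: "sets (borel :: bool measure) = UNIV"
    by (auto intro: borel_open Topological_Spaces.open_discrete)
  have "sets (PiM UNIV (\<lambda>_::nat. uniform_count_measure (UNIV :: bool set)))
      = sets (PiM UNIV (\<lambda>_::nat. borel :: bool measure))"
    by (intro sets_PiM_cong) (auto simp: sets_uniform_count_measure borel_bool)
  also have "\<dots> = sets borel" by (rule sets_PiM_equal_borel)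
  finally show ?thesis .
qed

lemma borel_sets_cantor_measure: "A \<in> sets borel \<Longrightarrow> A \<in> sets cantor_measure"
  unfolding cantor_measure_def using sets_PiM_bool_eq_borel by blast

lemma measure_coordinates_eq:
  assumes "finite A"
  shows "measure cantor_measure {x. \<forall>i\<in>A. x i = s i} = (1/2) ^ card A"
proof -
  let ?M = "\<lambda>_::nat. uniform_count_measure (UNIV :: bool set)"
  interpret product_prob_space ?M UNIV
    by (intro product_prob_spaceI prob_space_uniform_count_measure) auto
  have meas: "{x. \<forall>i\<in>A. x i = s i} \<in> sets (PiM UNIV ?M)"
    unfolding sets_PiM_bool_eq_borel by (intro borel_open open_coordinates_eq assms)
  have "emeasure (PiM UNIV ?M) {x. \<forall>i\<in>A. x i = s i}
      = (\<Prod>i\<in>A. emeasure (?M i) {s i})"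
    using emeasure_PiM_Collect[of A "\<lambda>i. {s i}"] assms
    by (simp add: space_PiM sets_uniform_count_measure space_uniform_count_measure)
  also have "\<dots> = ennreal ((1/2) ^ card A)"
    by (simp add: emeasure_uniform_count_measure flip: ennreal_power)
  finally have "measure (PiM UNIV ?M) {x. \<forall>i\<in>A. x i = s i} = (1/2) ^ card A"
    by (simp add: measure_def)
  then show ?thesis
    unfolding cantor_measure_def using measure_completion[OF meas] by simp
qed

text \<open>A nonempty open set contains a cylinder of some length \<open>n\<close>, which has
  positive measure \<open>(1/2) ^ n\<close>.\<close>

lemma null_interior_empty:
  assumes "A \<in> null_sets cantor_measure"
  shows "interior A = {}"
proof (rule ccontr)
  assume "interior A \<noteq> {}"
  then obtain x n where "cylinder n x \<subseteq> interior A"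
    using open_interior[of A] unfolding open_cantor_iff by blast
  then have "cylinder n x \<in> null_sets cantor_measure"
    using assms interior_subset null_cantor_subset by blast
  then have "measure cantor_measure (cylinder n x) = 0"
    by (auto simp: null_sets_def measure_def)
  then show False
    using measure_coordinates_eq[of "{..<n}" x] by (simp add: cylinder_def Ball_def)
qed

text \<open>The points agreeing with some element of \<open>F\<close> below \<open>n\<close> form a
  clopen set \<open>C n\<close>, and these sets decrease to \<open>F\<close> because
  \<open>F\<close> is closed. Continuity of the measure from above finishes the argument.\<close>

lemma closed_null_clopen_superset:
  assumes "closed F" "F \<in> null_sets cantor_measure" "\<epsilon> > 0"
  shows "\<exists>c\<in>clopen_sets. F \<subseteq> c \<and> measure cantor_measure c < \<epsilon>"
proof -
  define C where "C n = (\<Union>x\<in>F. cylinder n x)" for n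
  have clopen: "open (C n)" "closed (C n)" for n
    by (rule clopen_if_finite_support[of n]; auto simp: C_def cylinder_def)+
  have F_C: "F \<subseteq> C n" for n
    using cylinder_self by (auto simp: C_def)
  have "(\<Inter>n. C n) \<subseteq> F"
  proof (rule ccontr)
    assume "\<not> ?thesis"
    then obtain x where x: "\<And>n. x \<in> C n" "x \<in> - F" by blast
    then obtain n where n: "cylinder n x \<subseteq> - F"
      using assms(1) by (metis closed_def open_cantor_iff)
    obtain y where "y \<in> F" "x \<in> cylinder n y"
      using x(1)[of n] by (auto simp: C_def)
    then show False using n by (auto simp: cylinder_def)
  qed
  with F_C have Inter: "(\<Inter>n. C n) = F" by blast
  have "decseq C"
    using cylinder_antimono by (fastforce simp: C_def decseq_def)
  moreover have "range C \<subseteq> sets cantor_measure"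
    using clopen(1) by (auto intro: borel_sets_cantor_measure)
  ultimately have "(\<lambda>n. measure cantor_measure (C n)) \<longlonglongrightarrow> measure cantor_measure (\<Inter>n. C n)"
    by (rule cantor.finite_Lim_measure_decseq[rotated])
  moreover have "measure cantor_measure F = 0"
    using assms(2) by (auto simp: null_sets_def measure_def)
  ultimately have "\<forall>\<^sub>F n in sequentially. measure cantor_measure (C n) < \<epsilon>"
    using Inter assms(3) by (simp add: order_tendsto_iff)
  then obtain n where "measure cantor_measure (C n) < \<epsilon>"
    by (auto simp: eventually_sequentially)
  then show ?thesis
    using F_C clopen by (intro bexI[of _ "C n"]) (simp_all add: clopen_sets_def)
qed

text \<open>Borel--Cantelli, since \<open>N_limsup c\<close> is the set-theoretic limsup. Both
  sequences constructed below enter \<open>Omega_bar\<close> through this criterion.\<close>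

lemma Omega_barI_summable:
  assumes "\<And>n. c n \<in> clopen_sets" "summable (\<lambda>n. measure cantor_measure (c n))"
  shows "c \<in> Omega_bar"
proof -
  have "c n \<in> sets cantor_measure" for n
    using assms(1) by (auto simp: clopen_sets_def intro: borel_sets_cantor_measure)
  then have "limsup c \<in> null_sets cantor_measure"
    using assms(2) by (intro borel_cantelli_limsup1) (auto simp: cantor.emeasure_eq_measure)
  moreover have "N_limsup c = limsup c"
    by (auto simp: N_limsup_def limsup_INF_SUP infinite_nat_iff_unbounded_le)
  ultimately show ?thesis using assms(1) by (simp add: Omega_bar_def)
qed

section \<open>The ideal generated by the closed null sets\<close>

text \<open>The sets with such a cover form a sigma-ideal containing the generators, where a pairing
  function merges countably many covers. Conversely, every sigma-ideal containing the generators
  contains all sets so covered.\<close>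

lemma closed_null_ideal_iff:
  "X \<in> closed_null_ideal \<longleftrightarrow>
     (\<exists>F :: nat \<Rightarrow> cantor set. (\<forall>n. closed (F n) \<and> F n \<in> null_sets cantor_measure) \<and> X \<subseteq> (\<Union>n. F n))"
proof
  define I where "I = {X. \<exists>F :: nat \<Rightarrow> cantor set.
    (\<forall>n. closed (F n) \<and> F n \<in> null_sets cantor_measure) \<and> X \<subseteq> (\<Union>n. F n)}"
  have "(\<Union>n. A n) \<in> I" if A: "range A \<subseteq> I" for A :: "nat \<Rightarrow> cantor set"
  proof -
    have "\<forall>n. \<exists>F :: nat \<Rightarrow> cantor set.
        (\<forall>m. closed (F m) \<and> F m \<in> null_sets cantor_measure) \<and> A n \<subseteq> (\<Union>m. F m)"
      using A by (simp add: I_def image_subset_iff)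
    then obtain F :: "nat \<Rightarrow> nat \<Rightarrow> cantor set" where
      F: "\<And>n m. closed (F n m) \<and> F n m \<in> null_sets cantor_measure" "\<And>n. A n \<subseteq> (\<Union>m. F n m)"
      by metis
    have "(\<Union>n. A n) \<subseteq> (\<Union>p. case prod_decode p of (n, m) \<Rightarrow> F n m)"
    proof
      fix x assume "x \<in> (\<Union>n. A n)"
      then obtain n m where "x \<in> F n m" using F(2) by blast
      then show "x \<in> (\<Union>p. case prod_decode p of (n, m) \<Rightarrow> F n m)"
        by (intro UN_I[of "prod_encode (n, m)"]) auto
    qed
    then show ?thesis
      unfolding I_def using F(1) by (intro CollectI exI[of _ "\<lambda>p. case prod_decode p of (n, m) \<Rightarrow> F n m"])
        (auto split: prod.split)
  qed
  moreover have "{} \<in> I" by (auto simp: I_def intro!: exI[of _ "\<lambda>_. {}"])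
  moreover have "B \<in> I" if "A \<in> I" "B \<subseteq> A" for A B
    using that unfolding I_def by (blast intro: subset_trans)
  ultimately have "sigma_ideal I" unfolding sigma_ideal_def by blast
  moreover have "{C. closed C \<and> C \<in> null_sets cantor_measure} \<subseteq> I"
  proof
    fix C :: "cantor set" assume "C \<in> {C. closed C \<and> C \<in> null_sets cantor_measure}"
    then show "C \<in> I" unfolding I_def by (intro CollectI exI[of _ "\<lambda>_. C"]) auto
  qed
  moreover assume "X \<in> closed_null_ideal"
  ultimately have "X \<in> I"
    unfolding closed_null_ideal_def sigma_ideal_generated_def by blast
  then show "\<exists>F :: nat \<Rightarrow> cantor set.
      (\<forall>n. closed (F n) \<and> F n \<in> null_sets cantor_measure) \<and> X \<subseteq> (\<Union>n. F n)"
    by (simp add: I_def)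
next
  assume "\<exists>F :: nat \<Rightarrow> cantor set.
    (\<forall>n. closed (F n) \<and> F n \<in> null_sets cantor_measure) \<and> X \<subseteq> (\<Union>n. F n)"
  then obtain F :: "nat \<Rightarrow> cantor set" where
    F: "\<And>n. closed (F n) \<and> F n \<in> null_sets cantor_measure" "X \<subseteq> (\<Union>n. F n)"
    by blast
  show "X \<in> closed_null_ideal"
    unfolding closed_null_ideal_def sigma_ideal_generated_def
  proof (rule InterI)
    fix I assume "I \<in> {I. sigma_ideal I \<and> {C. closed C \<and> C \<in> null_sets cantor_measure} \<subseteq> I}"
    then have I: "sigma_ideal I" "range F \<subseteq> I" using F(1) by auto
    then have "(\<Union>n. F n) \<in> I" unfolding sigma_ideal_def by blast
    then show "X \<in> I" using I(1) F(2) unfolding sigma_ideal_def by blast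
  qed
qed

lemma closed_null_ideal_subset_meager: "closed_null_ideal \<subseteq> meager_ideal"
proof
  fix X assume "X \<in> closed_null_ideal"
  then obtain F :: "nat \<Rightarrow> cantor set" where
    "\<forall>n. closed (F n) \<and> F n \<in> null_sets cantor_measure" "X \<subseteq> (\<Union>n. F n)"
    unfolding closed_null_ideal_iff by blast
  then have "meager X"
    unfolding meager_iff_closed_cover using null_interior_empty by (intro exI[of _ F]) simp
  then show "X \<in> meager_ideal" by (simp add: meager_ideal_def)
qed

section \<open>The families \<open>N_star_family J\<close>\<close>

context
  fixes J :: "nat set set"
  assumes ideal: "ideal_on_omega J"
begin

lemma ideal_subset: "a \<in> J \<Longrightarrow> b \<subseteq> a \<Longrightarrow> b \<in> J"
  using ideal unfolding ideal_on_omega_def by blast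

lemma mem_dual_filter_iff: "a \<in> dual_filter J \<longleftrightarrow> - a \<in> J"
proof
  assume "- a \<in> J"
  then show "a \<in> dual_filter J"
    unfolding dual_filter_def by (intro CollectI exI[of _ "- a"]) auto
qed (auto simp: dual_filter_def Compl_Diff_eq)

text \<open>A finite member would lie in \<open>J\<close> together with its complement, putting all
  of \<omega> into \<open>J\<close>.\<close>

lemma dual_filter_infinite:
  assumes "a \<in> dual_filter J"
  shows "infinite a"
proof
  assume "finite a"
  then have "a \<in> J" "- a \<in> J"
    using ideal assms by (auto simp: ideal_on_omega_def mem_dual_filter_iff)
  then have "a \<union> - a \<in> J" using ideal unfolding ideal_on_omega_def by blast
  then show False using ideal by (simp add: ideal_on_omega_def)
qed

text \<open>Sets in the dual filter are infinite, so \<open>N_star J c\<close> lies in the null set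
  \<open>N_limsup c\<close>. This makes (i) and (ii) equivalent.\<close>

lemma N_star_family_subset_null: "N_star_family J \<subseteq> null_ideal"
proof
  fix X assume "X \<in> N_star_family J"
  then obtain c where c: "c \<in> Omega_bar" "X \<subseteq> N_star J c"
    by (auto simp: N_star_family_def)
  have "N_star J c \<subseteq> N_limsup c"
    using dual_filter_infinite by (auto simp: N_star_def N_limsup_def)
  then show "X \<in> null_ideal"
    using c null_cantor_subset by (auto simp: null_ideal_def Omega_bar_def)
qed

lemma closed_null_ideal_subset_N_star_family: "closed_null_ideal \<subseteq> N_star_family J"
proof
  fix X assume "X \<in> closed_null_ideal"
  then obtain F :: "nat \<Rightarrow> cantor set" where F: "\<And>n. closed (F n)"
    "\<And>n. F n \<in> null_sets cantor_measure" "X \<subseteq> (\<Union>n. F n)"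
    unfolding closed_null_ideal_iff by blast
  \<comment> \<open>Covering the first \<open>n + 1\<close> sets at once puts each point of
    \<open>F m\<close> into \<open>c n\<close> for all \<open>n \<ge> m\<close>, a cofinite set of
    indices. The bound \<open>(1/2) ^ n\<close> makes the measures summable.\<close>
  have "\<exists>c\<in>clopen_sets. (\<Union>i\<le>n. F i) \<subseteq> c \<and> measure cantor_measure c < (1/2) ^ n" for n
    using F(1,2) by (intro closed_null_clopen_superset closed_UN null_sets_UN') auto
  then obtain c where c: "\<And>n. c n \<in> clopen_sets" "\<And>n. (\<Union>i\<le>n. F i) \<subseteq> c n"
    "\<And>n. measure cantor_measure (c n) < (1/2) ^ n"
    by metis
  have "summable (\<lambda>n. measure cantor_measure (c n))"
    by (rule summable_comparison_test'[of "\<lambda>n. (1/2) ^ n" 0])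
      (use c(3) in \<open>auto intro: less_imp_le summable_geometric\<close>)
  then have "c \<in> Omega_bar" using c(1) by (intro Omega_barI_summable)
  moreover have "X \<subseteq> N_star J c"
  proof
    fix x assume "x \<in> X"
    then obtain m where "x \<in> F m" using F(3) by blast
    then have "x \<in> c n" if "n \<ge> m" for n using c(2)[of n] that by blast
    then have "- {n. x \<in> c n} \<subseteq> {..<m}" by (auto simp: not_le[symmetric])
    then have "finite (- {n. x \<in> c n})" using finite_subset by blast
    then show "x \<in> N_star J c"
      using ideal by (simp add: N_star_def mem_dual_filter_iff ideal_on_omega_def)
  qed
  ultimately show "X \<in> N_star_family J" by (auto simp: N_star_family_def)
qed

text \<open>One half of the Jalali-Naini--Talagrand characterization of meager ideals, stated for
  the dual filter. The pattern \<open>z\<close> given by meagerness is eliminated by restricting it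
  to the complement of \<open>a\<close>, which leaves a member of \<open>J\<close>.\<close>

lemma meager_ideal_blocks:
  assumes "meager_family J"
  shows "\<exists>k. strict_mono k \<and>
    (\<forall>a\<in>dual_filter J. \<forall>\<^sub>F n in sequentially. a \<inter> {k n..<k (Suc n)} \<noteq> {})"
proof -
  obtain k z where k: "strict_mono k"
    and z: "(\<lambda>a n. n \<in> a) ` J \<subseteq> eventually_differs (id \<circ> k) z"
    using meager_subset_eventually_differs[of _ id] assms
    unfolding meager_family_def by (metis strict_mono_id)
  have "\<forall>\<^sub>F n in sequentially. a \<inter> {k n..<k (Suc n)} \<noteq> {}" if a: "a \<in> dual_filter J" for a
  proof -
    \<comment> \<open>On a block missed by \<open>a\<close> the set \<open>b\<close> coincides with \<open>z\<close>.\<close>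
    define b where "b = {i. i \<notin> a \<and> z i}"
    have "b \<in> J"
      using a ideal_subset[of "- a" b] by (auto simp: mem_dual_filter_iff b_def)
    then have "\<forall>\<^sub>F n in sequentially. \<exists>i\<in>{k n..<k (Suc n)}. (i \<in> b) \<noteq> z i"
      using z by (auto simp: eventually_differs_def)
    then show ?thesis
      by (rule eventually_mono) (auto simp: b_def)
  qed
  then show ?thesis using k by blast
qed

text \<open>An index set in the dual filter meets almost all blocks, so each point of
  \<open>N_star J c\<close> is in almost all block unions of \<open>c\<close>. The set
  \<open>F m\<close> of points in all block unions from \<open>m\<close> on is closed and lies in
  \<open>N_limsup c\<close>.\<close>

lemma meager_imp_N_star_family_subset:
  assumes "meager_family J"
  shows "N_star_family J \<subseteq> closed_null_ideal"
proof
  fix X assume "X \<in> N_star_family J"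
  then obtain c where c: "c \<in> Omega_bar" "X \<subseteq> N_star J c"
    by (auto simp: N_star_family_def)
  obtain k where k: "strict_mono k"
    and blocks: "\<And>a. a \<in> dual_filter J \<Longrightarrow> \<forall>\<^sub>F n in sequentially. a \<inter> {k n..<k (Suc n)} \<noteq> {}"
    using meager_ideal_blocks[OF assms] by blast
  define F where "F m = (\<Inter>n\<in>{m..}. \<Union>i\<in>{k n..<k (Suc n)}. c i)" for m
  have "closed (F m)" for m
    using c(1) by (auto simp: F_def Omega_bar_def clopen_sets_def)
  moreover have "F m \<in> null_sets cantor_measure" for m
  proof -
    have "\<exists>i\<ge>N. x \<in> c i" if x: "x \<in> F m" for x N
    proof -
      obtain i where "k (max m N) \<le> i" "x \<in> c i"
        using x by (force simp: F_def)
      \<comment> \<open>The block numbered \<open>max m N\<close> starts at or beyond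
        \<open>N\<close>.\<close>
      moreover have "max m N \<le> k (max m N)"
        using k by (rule strict_mono_imp_increasing)
      ultimately show ?thesis by (intro exI[of _ i]) auto
    qed
    then have "F m \<subseteq> N_limsup c"
      by (auto simp: N_limsup_def infinite_nat_iff_unbounded_le)
    then show ?thesis using c(1) null_cantor_subset by (auto simp: Omega_bar_def)
  qed
  moreover have "X \<subseteq> (\<Union>m. F m)"
  proof
    fix x assume "x \<in> X"
    then have "{n. x \<in> c n} \<in> dual_filter J" using c(2) by (auto simp: N_star_def)
    from blocks[OF this] obtain m where
      "\<forall>n\<ge>m. {n. x \<in> c n} \<inter> {k n..<k (Suc n)} \<noteq> {}"
      by (auto simp: eventually_sequentially)
    then have "x \<in> F m" by (fastforce simp: F_def)
    then show "x \<in> (\<Union>m. F m)" by blast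
  qed
  ultimately show "X \<in> closed_null_ideal" unfolding closed_null_ideal_iff by blast
qed

lemma nonmeager_imp_N_star_family_not_meager:
  assumes "\<not> meager_family J"
  shows "\<not> N_star_family J \<subseteq> meager_ideal"
proof
  assume sub: "N_star_family J \<subseteq> meager_ideal"
  \<comment> \<open>Interval \<open>j\<close> has length \<open>2 * j + 1\<close>, so
    \<open>c j\<close> has measure at most \<open>(1/2) ^ j\<close>; \<open>g 0 = 0\<close> makes
    the intervals exhaust \<omega>.\<close>
  define g :: "nat \<Rightarrow> nat" where "g j = j * j" for j
  have g: "strict_mono g" by (simp add: strict_mono_Suc_iff g_def)
  define c :: "nat \<Rightarrow> cantor set" where "c j = {x. \<forall>i\<in>{g j..<g (Suc j)}. x i = False}" for j
  have "c j \<in> clopen_sets" for j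
    unfolding clopen_sets_def using clopen_if_finite_support[of "g (Suc j)" "c j"]
    by (auto simp: c_def cylinder_def)
  moreover have "summable (\<lambda>j. measure cantor_measure (c j))"
  proof (rule summable_comparison_test'[of "\<lambda>j. (1/2) ^ j" 0])
    fix j :: nat
    have "measure cantor_measure (c j) = (1/2) ^ card {g j..<g (Suc j)}"
      unfolding c_def by (rule measure_coordinates_eq) simp
    also have "\<dots> \<le> (1/2) ^ j"
      by (rule power_decreasing) (auto simp: g_def)
    finally show "norm (measure cantor_measure (c j)) \<le> (1/2) ^ j" by simp
  qed (simp add: summable_geometric)
  ultimately have "c \<in> Omega_bar" by (rule Omega_barI_summable)
  then have "meager (N_star J c)"
    using sub by (auto simp: N_star_family_def meager_ideal_def)
  then obtain k z where k: "strict_mono k" and cover: "N_star J c \<subseteq> eventually_differs (g \<circ> k) z"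
    using meager_subset_eventually_differs g by blast
  \<comment> \<open>The image of \<open>z\<close> under the map sending \<open>x\<close> to the set
    of \<open>j\<close> with \<open>x \<notin> c j\<close>; it becomes the pattern for covering
    \<open>J\<close>.\<close>
  define w where "w j \<longleftrightarrow> z \<notin> c j" for j
  have g_block: "j = j'" if i: "i \<in> {g j..<g (Suc j)}" "i \<in> {g j'..<g (Suc j')}" for i j j'
  proof -
    have "g j < g (Suc j')" "g j' < g (Suc j)" using i by auto
    then show ?thesis using strict_mono_less[OF g] by (simp add: less_Suc_eq_le)
  qed
  have ex_block: "\<exists>j. i \<in> {g j..<g (Suc j)}" for i
  proof -
    define j where "j = (LEAST j. i < g (Suc j))"
    have "i < g (Suc i)" by (simp add: g_def)
    then have "i < g (Suc j)" unfolding j_def by (rule LeastI)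
    moreover have "g j \<le> i"
    proof (cases j)
      case (Suc j')
      then show ?thesis using not_less_Least[of j' "\<lambda>j. i < g (Suc j)"] by (simp add: j_def)
    qed (simp add: g_def)
    ultimately show ?thesis by auto
  qed
  have "(\<lambda>n. n \<in> a) \<in> eventually_differs k w" if a: "a \<in> J" for a
  proof -
    define idx where "idx i = (SOME j. i \<in> {g j..<g (Suc j)})" for i
    have idx: "i \<in> {g (idx i)..<g (Suc (idx i))}" for i
      unfolding idx_def using ex_block by (rule someI_ex)
    have idx_eq: "idx i = j" if "i \<in> {g j..<g (Suc j)}" for i j
      using g_block idx that by blast
    \<comment> \<open>A preimage of \<open>a\<close> copying \<open>z\<close> on each interval where \<open>a\<close> agrees with \<open>w\<close>.\<close>
    define x where "x i = (if (idx i \<in> a) = w (idx i) then z i else idx i \<in> a)" for i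
    have x_c: "x \<in> c j \<longleftrightarrow> j \<notin> a" for j
    proof (cases "(j \<in> a) = w j")
      case True
      then have "\<forall>i\<in>{g j..<g (Suc j)}. x i = z i" by (simp add: x_def idx_eq)
      then have "x \<in> c j \<longleftrightarrow> z \<in> c j" by (simp add: c_def)
      then show ?thesis using True by (simp add: w_def)
    next
      case False
      \<comment> \<open>Here \<open>x\<close> is constant on interval \<open>j\<close>. As the
        interval is nonempty, \<open>x\<close> vanishes on it exactly when
        \<open>j \<notin> a\<close>.\<close>
      then have "\<forall>i\<in>{g j..<g (Suc j)}. x i = (j \<in> a)" by (simp add: x_def idx_eq)
      moreover have "g j \<in> {g j..<g (Suc j)}" using strict_monoD[OF g, of j "Suc j"] by simp
      ultimately show ?thesis unfolding c_def by blast
    qed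
    have "- {n. x \<in> c n} = a" using x_c by auto
    then have "x \<in> N_star J c" using a by (simp add: N_star_def mem_dual_filter_iff)
    then have "\<forall>\<^sub>F n in sequentially. \<exists>i\<in>{g (k n)..<g (k (Suc n))}. x i \<noteq> z i"
      using cover by (auto simp: eventually_differs_def)
    then have "\<forall>\<^sub>F n in sequentially. \<exists>j\<in>{k n..<k (Suc n)}. (j \<in> a) \<noteq> w j"
    proof (rule eventually_mono)
      fix n assume "\<exists>i\<in>{g (k n)..<g (k (Suc n))}. x i \<noteq> z i"
      then obtain i where i: "g (k n) \<le> i" "i < g (k (Suc n))" "x i \<noteq> z i"
        unfolding Bex_def atLeastLessThan_iff by blast
      \<comment> \<open>Block boundaries are values of \<open>g\<close>, so no interval straddles
        two blocks. A position where \<open>x\<close> differs from \<open>z\<close> lies in an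
        interval on which \<open>a\<close> and \<open>w\<close> disagree.\<close>
      have "g (k n) < g (Suc (idx i))" "g (idx i) < g (k (Suc n))"
        using i idx[of i] by auto
      then have "idx i \<in> {k n..<k (Suc n)}"
        using strict_mono_less[OF g] by (simp add: less_Suc_eq_le)
      moreover have "(idx i \<in> a) \<noteq> w (idx i)" using i(3) unfolding x_def by presburger
      ultimately show "\<exists>j\<in>{k n..<k (Suc n)}. (j \<in> a) \<noteq> w j" by blast
    qed
    then show ?thesis by (simp add: eventually_differs_def)
  qed
  then have "(\<lambda>a n. n \<in> a) ` J \<subseteq> eventually_differs k w" by blast
  then show False
    using assms meager_eventually_differs[OF k] meager_subset unfolding meager_family_def by blast
qed

end

theorem theorem3p11:
  fixes J :: "nat set set"
  assumes "ideal_on_omega J"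
  shows "(\<not> N_star_family J \<subseteq> meager_ideal
            \<longleftrightarrow> \<not> N_star_family J \<subseteq> meager_ideal \<inter> null_ideal)
       \<and> (\<not> N_star_family J \<subseteq> meager_ideal \<inter> null_ideal
            \<longleftrightarrow> closed_null_ideal \<subset> N_star_family J)
       \<and> (closed_null_ideal \<subset> N_star_family J \<longleftrightarrow> \<not> meager_family J)"
proof -
  note facts = N_star_family_subset_null[OF assms] closed_null_ideal_subset_N_star_family[OF assms]
    closed_null_ideal_subset_meager
  \<comment> \<open>Equality of the two families would make every member of
    \<open>N_star_family J\<close> meager. This starts the cycle from (i) to (iii) to (iv) and back
    to (i).\<close>
  have "closed_null_ideal \<subset> N_star_family J" if "\<not> N_star_family J \<subseteq> meager_ideal"
    using facts(2,3) that by blast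
  moreover have "\<not> meager_family J" if "closed_null_ideal \<subset> N_star_family J"
    using meager_imp_N_star_family_subset[OF assms] that by blast
  ultimately show ?thesis
    using facts(1) nonmeager_imp_N_star_family_not_meager[OF assms] by blast
qed

end
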